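(* Let $A,E\in\mathbb{C}^{n,n}$ be Hermitian and let $L(s)=A+sE$ be a regular pencil. Then $$\delta_0^{\mathrm{Herm}}(A,E)=\sqrt{\lambda_{\min}(A^*A+E^*E)}=\delta_0(A,E).$$
   Context: $\mathbb{C}^{n,n}$ is the set of complex $n\times n$ matrices. A pencil $A+sE$ is regular if $A+\lambda E$ is invertible for some $\lambda\in\mathbb{C}$. $\|\cdot\|$ is the spectral norm and $\lambda_{\min}(H)$ is the smallest eigenvalue of a Hermitian matrix $H$. For $\mathbb{S}\subseteq(\mathbb{C}^{n,n})^2$ the structured distance to a common null space is $$\delta_0^{\mathbb{S}}(A,E)=\inf\Big\{\sqrt{\|\Delta_A\|^2+\|\Delta_E\|^2}\;:\;(\Delta_A,\Delta_E)\in\mathbb{S},\ \ker(A-\Delta_A)\cap\ker(E-\Delta_E)\neq\{0\}\Big\}.$$ $\delta_0^{\mathrm{Herm}}$ denotes $\delta_0^{\mathbb{S}}$ for $\mathbb{S}=(\mathrm{Herm}(n))^2$, where $\mathrm{Herm}(n)$ is the set of $n\times n$ complex Hermitian matrices, and $\delta_0$ denotes $\delta_0^{\mathbb{S}}$ for $\mathbb{S}=(\mathbb{C}^{n,n})^2$. *)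

theory Defs
  imports "HOL-Analysis.Analysis"
begin

text \<open>
  Complex n-by-n matrices are elements of \<^typ>\<open>complex^'n^'n\<close>; the dimension n is
  \<open>CARD('n)\<close>, an arbitrary positive integer.
\<close>

definition conj_transpose :: "complex^'n^'n \<Rightarrow> complex^'n^'n"
  where "conj_transpose M = (\<chi> i j. cnj (M $ j $ i))"

definition Herm :: "(complex^'n^'n) set"
  where "Herm = {M. conj_transpose M = M}"

definition regular_pencil :: "complex^'n^'n \<Rightarrow> complex^'n^'n \<Rightarrow> bool"
  where "regular_pencil A E \<longleftrightarrow> (\<exists>l::complex. invertible (\<chi> i j. A $ i $ j + l * E $ i $ j))"

definition ker :: "complex^'n^'n \<Rightarrow> (complex^'n) set"
  where "ker M = {x. M *v x = 0}"

text \<open>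
  The norm of \<^typ>\<open>complex^'n\<close> is the Euclidean one, so its operator norm is the spectral norm.
\<close>

definition spectral_norm :: "complex^'n^'n \<Rightarrow> real"
  where "spectral_norm M = onorm ((*v) M)"

definition eigenvalue :: "complex^'n^'n \<Rightarrow> complex \<Rightarrow> bool"
  where "eigenvalue M l \<longleftrightarrow> (\<exists>x. x \<noteq> 0 \<and> M *v x = l *s x)"

text \<open>
  Meaningful for Hermitian \<open>H\<close> only: all eigenvalues are then real, and the least one exists.
\<close>

definition lambda_min :: "complex^'n^'n \<Rightarrow> real"
  where "lambda_min H = (LEAST l::real. eigenvalue H (complex_of_real l))"

text \<open>
  The distance takes values in the extended reals, so that the infimum over an empty set of
  admissible perturbations is \<open>\<infinity>\<close>.
\<close>

definition dist_common_null ::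
    "((complex^'n^'n) \<times> (complex^'n^'n)) set \<Rightarrow> complex^'n^'n \<Rightarrow> complex^'n^'n \<Rightarrow> ereal"
  where "dist_common_null S A E =
    Inf {ereal (sqrt ((spectral_norm DA)\<^sup>2 + (spectral_norm DE)\<^sup>2)) | DA DE.
          (DA, DE) \<in> S \<and> ker (A - DA) \<inter> ker (E - DE) \<noteq> {0}}"

end

theory Submission
  imports Defs
begin

text \<open>
  Let \<open>H = A\<^sup>* A + E\<^sup>* E\<close>, so that \<open>x\<^sup>* H x = \<parallel>A x\<parallel>\<^sup>2 + \<parallel>E x\<parallel>\<^sup>2\<close>. By the Rayleigh
  principle (\<open>Rayleigh_principle\<close>) the least eigenvalue of \<open>H\<close> is the minimum of this
  quantity over unit vectors, and a unit eigenvector attains it.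

  If a unit vector \<open>x\<close> lies in both kernels after the perturbation, then \<open>A x = \<Delta>\<^sub>A x\<close> and
  \<open>E x = \<Delta>\<^sub>E x\<close>, hence \<open>\<parallel>\<Delta>\<^sub>A\<parallel>\<^sup>2 + \<parallel>\<Delta>\<^sub>E\<parallel>\<^sup>2 \<ge> \<parallel>A x\<parallel>\<^sup>2 + \<parallel>E x\<parallel>\<^sup>2 \<ge> \<lambda>\<^sub>m\<^sub>i\<^sub>n(H)\<close>. This bounds the
  distance from below for every structure class (\<open>dist_common_null_lower_bound\<close>).

  Conversely, let \<open>x\<close> be a minimising unit eigenvector. It suffices to find Hermitian
  \<open>\<Delta>\<^sub>A\<close> with \<open>\<Delta>\<^sub>A x = A x\<close> and \<open>\<parallel>\<Delta>\<^sub>A\<parallel> \<le> \<parallel>A x\<parallel>\<close>, and likewise for \<open>E\<close>. The only obstruction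
  to a Hermitian matrix sending \<open>x\<close> to \<open>b\<close> is that \<open>x\<^sup>* b\<close> must be real, which holds for
  \<open>b = A x\<close> because \<open>A\<close> is Hermitian; a multiple of the Householder reflection that
  exchanges \<open>x\<close> and \<open>b / \<parallel>b\<parallel>\<close> then does it without increasing the norm
  (\<open>Hermitian_mapping\<close>). So the lower bound is attained already by Hermitian perturbations,
  and a fortiori by unrestricted ones.
\<close>

section \<open>The Hermitian inner product\<close>

text \<open>
  The inner product of the library on \<^typ>\<open>complex^'n\<close> is the real part of this one. The real
  part suffices for norms and for the variational argument, but the coefficient in a
  complex Householder reflection is the full sesquilinear product.
\<close>

definition cinner :: "complex^'n \<Rightarrow> complex^'n \<Rightarrow> complex"
  where "cinner x y = (\<Sum>i\<in>UNIV. cnj (x $ i) * y $ i)"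

lemma Re_cinner: "Re (cinner x y) = x \<bullet> y"
  by (simp add: cinner_def inner_vec_def inner_complex_def)

lemma cnj_cinner: "cnj (cinner x y) = cinner y x"
  by (simp add: cinner_def mult.commute)

lemma cinner_self: "cinner x x = of_real ((norm x)\<^sup>2)"
proof (rule complex_eqI)
  show "Re (cinner x x) = Re (of_real ((norm x)\<^sup>2))"
    by (simp add: Re_cinner power2_norm_eq_inner)
  have "cnj (cinner x x) = cinner x x"
    by (rule cnj_cinner)
  then show "Im (cinner x x) = Im (of_real ((norm x)\<^sup>2))"
    by (metis Im_complex_of_real complex_In_mult_cnj_zero Reals_cnj_iff complex_is_Real_iff)
qed

lemma cinner_diff_left: "cinner (x - y) z = cinner x z - cinner y z"
  and cinner_diff_right: "cinner z (x - y) = cinner z x - cinner z y"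
  and cinner_scale_left: "cinner (c *s x) z = cnj c * cinner x z"
  and cinner_scale_right: "cinner z (c *s x) = c * cinner z x"
  by (simp_all add: cinner_def algebra_simps sum_subtractf sum_distrib_left)

lemma cinner_conj_transpose: "cinner (conj_transpose M *v x) y = cinner x (M *v y)"
proof -
  have "cinner (conj_transpose M *v x) y
      = (\<Sum>i\<in>UNIV. \<Sum>j\<in>UNIV. M $ j $ i * cnj (x $ j) * y $ i)"
    by (simp add: cinner_def conj_transpose_def matrix_vector_mult_def sum_distrib_right)
  also have "\<dots> = (\<Sum>j\<in>UNIV. \<Sum>i\<in>UNIV. M $ j $ i * cnj (x $ j) * y $ i)"
    by (rule sum.swap)
  also have "\<dots> = cinner x (M *v y)"
    by (simp add: cinner_def matrix_vector_mult_def sum_distrib_left mult_ac)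
  finally show ?thesis .
qed

lemma inner_conj_transpose: "(conj_transpose M *v x) \<bullet> y = x \<bullet> (M *v y)"
  by (metis Re_cinner cinner_conj_transpose)

lemma bounded_linear_matrix: "bounded_linear ((*v) (M :: complex^'n^'m))"
proof -
  have "linear ((*v) M)"
    by (rule linearI)
      (simp_all add: vec_eq_iff matrix_vector_mult_def algebra_simps sum.distrib
        scaleR_sum_right)
  then show ?thesis
    by (simp add: linear_conv_bounded_linear)
qed

section \<open>The Rayleigh principle\<close>

text \<open>
  A minimiser \<open>x\<close> of a nonnegative quadratic form with value 0 is annihilated by it: moving
  from \<open>x\<close> against \<open>G x\<close> would otherwise make the form negative to first order.
\<close>

lemma nonneg_form_null_vector:
  fixes G :: "'a::real_inner \<Rightarrow> 'a"
  assumes lin: "linear G"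
    and sym: "\<And>y z. G y \<bullet> z = y \<bullet> G z"
    and nonneg: "\<And>y. 0 \<le> y \<bullet> G y"
    and null: "x \<bullet> G x = 0"
  shows "G x = 0"
proof (rule ccontr)
  assume "G x \<noteq> 0"
  \<comment> \<open>The step \<open>t\<close> is so short that the second-order term \<open>t\<^sup>2 K\<close> undoes at most half of the
    first-order decrease \<open>2 t \<parallel>G x\<parallel>\<^sup>2\<close>; the summand 1 only avoids dividing by zero.\<close>
  define K t where "K = G x \<bullet> G (G x)" and "t = (G x \<bullet> G x) / (1 + K)"
  have K: "0 \<le> K"
    unfolding K_def by (rule nonneg)
  have pos: "0 < G x \<bullet> G x"
    using \<open>G x \<noteq> 0\<close> by simp
  have t: "0 < t" "t * K \<le> G x \<bullet> G x"
    using K pos by (auto simp: t_def field_simps add_pos_nonneg)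
  have "(x - t *\<^sub>R G x) \<bullet> G (x - t *\<^sub>R G x) = t * (t * K - 2 * (G x \<bullet> G x))"
    using null sym[of x "G x"]
    by (simp add: linear_diff[OF lin] linear_scale[OF lin] inner_diff_left inner_diff_right
        K_def algebra_simps)
  also have "\<dots> < 0"
    using t pos by (intro mult_pos_neg) linarith+
  finally show False
    using nonneg[of "x - t *\<^sub>R G x"] by simp
qed

lemma scaled_eq_scaleR: "of_real c *s (x :: complex^'n) = c *\<^sub>R x"
  by (simp add: vec_eq_iff) (simp add: scaleR_conv_of_real)

text \<open>
  The minimum of the form on the compact unit sphere is an eigenvalue by the previous lemma,
  and no eigenvalue is below it, since an eigenvalue is a value of the form.
\<close>

lemma Rayleigh_principle:
  fixes H :: "complex^'n^'n"
  assumes "H \<in> Herm"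
  obtains x where "norm x = 1" "x \<bullet> (H *v x) = lambda_min H"
    and "\<And>y. lambda_min H * (norm y)\<^sup>2 \<le> y \<bullet> (H *v y)"
proof -
  interpret H: bounded_linear "(*v) H"
    by (rule bounded_linear_matrix)
  have sym: "(H *v y) \<bullet> z = y \<bullet> (H *v z)" for y z
    using assms inner_conj_transpose[of H y z] by (simp add: Herm_def)
  have "continuous_on (sphere 0 1) (\<lambda>x. x \<bullet> (H *v x))"
    by (intro continuous_intros H.continuous_on)
  moreover have "sphere 0 1 \<noteq> ({} :: (complex^'n) set)"
    by simp
  ultimately obtain x where x: "norm x = 1"
    and min: "\<And>y. norm y = 1 \<Longrightarrow> x \<bullet> (H *v x) \<le> y \<bullet> (H *v y)"
    using continuous_attains_inf[of "sphere 0 1" "\<lambda>x. x \<bullet> (H *v x)"] by auto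
  define \<mu> where "\<mu> = x \<bullet> (H *v x)"
  have bound: "\<mu> * (norm y)\<^sup>2 \<le> y \<bullet> (H *v y)" for y
  proof (cases "y = 0")
    case False
    have "\<mu> \<le> (y /\<^sub>R norm y) \<bullet> (H *v (y /\<^sub>R norm y))"
      unfolding \<mu>_def using False by (intro min) simp
    also have "\<dots> = (y \<bullet> (H *v y)) / (norm y)\<^sup>2"
      by (simp add: H.scaleR power2_eq_square field_simps)
    finally show ?thesis
      using False by (simp add: field_simps)
  qed (simp add: H.zero)
  have "H *v x - \<mu> *\<^sub>R x = 0"
  proof (rule nonneg_form_null_vector[where G = "\<lambda>y. H *v y - \<mu> *\<^sub>R y"])
    show "linear (\<lambda>y. H *v y - \<mu> *\<^sub>R y)"
      by (rule linearI) (simp_all add: H.add H.scaleR algebra_simps)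
    show "(H *v y - \<mu> *\<^sub>R y) \<bullet> z = y \<bullet> (H *v z - \<mu> *\<^sub>R z)" for y z
      by (simp add: inner_diff_left inner_diff_right sym)
    show "0 \<le> y \<bullet> (H *v y - \<mu> *\<^sub>R y)" for y
      using bound[of y] by (simp add: inner_diff_right power2_norm_eq_inner)
    show "x \<bullet> (H *v x - \<mu> *\<^sub>R x) = 0"
      using x by (simp add: inner_diff_right \<mu>_def flip: power2_norm_eq_inner)
  qed
  then have "eigenvalue H (of_real \<mu>)"
    unfolding eigenvalue_def using x by (intro exI[of _ x]) (auto simp: scaled_eq_scaleR)
  moreover have "\<mu> \<le> l" if eig: "eigenvalue H (of_real l)" for l
  proof -
    obtain y where "y \<noteq> 0" and y: "H *v y = l *\<^sub>R y"
      using eig by (auto simp: eigenvalue_def scaled_eq_scaleR)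
    have "\<mu> * (norm y)\<^sup>2 \<le> l * (norm y)\<^sup>2"
      using bound[of y] by (simp add: y power2_norm_eq_inner)
    then show ?thesis
      using \<open>y \<noteq> 0\<close> by simp
  qed
  ultimately have "lambda_min H = \<mu>"
    unfolding lambda_min_def by (rule Least_equality)
  with x bound show ?thesis
    by (intro that[of x]) (simp_all add: \<mu>_def)
qed

lemma gram_Herm: "conj_transpose A ** A + conj_transpose E ** E \<in> Herm"
  by (simp add: Herm_def conj_transpose_def matrix_matrix_mult_def vec_eq_iff mult.commute)

lemma gram_form:
  "x \<bullet> ((conj_transpose A ** A + conj_transpose E ** E) *v x) = (norm (A *v x))\<^sup>2 + (norm (E *v x))\<^sup>2"
proof -
  have "x \<bullet> (conj_transpose M *v (M *v x)) = (norm (M *v x))\<^sup>2" for M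
    using inner_conj_transpose[of M "M *v x" x]
    by (simp add: power2_norm_eq_inner inner_commute)
  then show ?thesis
    by (simp add: matrix_vector_mult_add_rdistrib inner_add_right
        flip: matrix_vector_mul_assoc)
qed

section \<open>Hermitian matrices mapping one vector to another\<close>

text \<open>
  This is \<open>I - 2 v v\<^sup>* / (v\<^sup>* v)\<close>. Since division by zero gives zero, it is the identity for
  \<open>v = 0\<close>, which is the right reflection when a vector is to be mapped to itself.
\<close>

definition householder :: "complex^'n \<Rightarrow> complex^'n^'n"
  where "householder v =
    (\<chi> i j. (if i = j then 1 else 0) - of_real (2 / (norm v)\<^sup>2) * (v $ i * cnj (v $ j)))"

lemma householder_mult: "householder v *v y = y - (of_real (2 / (norm v)\<^sup>2) * cinner v y) *s v"
proof -
  have "(householder v *v y) $ i = (y - (of_real (2 / (norm v)\<^sup>2) * cinner v y) *s v) $ i" for i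
  proof -
    have "(householder v *v y) $ i
        = (\<Sum>j\<in>UNIV. (if i = j then y $ j else 0)
            - of_real (2 / (norm v)\<^sup>2) * v $ i * (cnj (v $ j) * y $ j))"
      unfolding householder_def matrix_vector_mult_def
      by (auto simp: algebra_simps intro!: sum.cong)
    also have "\<dots> = y $ i - of_real (2 / (norm v)\<^sup>2) * v $ i * cinner v y"
      by (simp only: sum_subtractf sum_distrib_left[symmetric] cinner_def) simp
    finally show ?thesis
      by (simp add: mult_ac)
  qed
  then show ?thesis
    by (simp add: vec_eq_iff)
qed

lemma householder_Herm: "householder v \<in> Herm"
  by (auto simp: Herm_def conj_transpose_def householder_def vec_eq_iff mult.commute)

lemma norm_householder: "norm (householder v *v y) = norm y"
proof (cases "v = 0")
  case True
  then show ?thesis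
    by (simp add: householder_mult)
next
  case False
  define r c where "r = 2 / (norm v)\<^sup>2" and "c = cinner v y"
  have r: "of_real r * cinner v v = 2"
    using False by (simp add: r_def cinner_self)
  have "cinner (householder v *v y) (householder v *v y)
      = cinner y y - of_real r * c * cnj c - of_real r * cnj c * c
        + of_real r * (cnj c * c) * (of_real r * cinner v v)"
    unfolding householder_mult r_def[symmetric] c_def[symmetric]
    by (simp add: cinner_diff_left cinner_diff_right cinner_scale_left cinner_scale_right
        c_def cnj_cinner algebra_simps)
  also have "\<dots> = cinner y y"
    by (simp add: r algebra_simps)
  finally have "(norm (householder v *v y))\<^sup>2 = (norm y)\<^sup>2"
    by (simp only: cinner_self of_real_eq_iff)
  then show ?thesis
    by simp
qed

text \<open>
  The difference \<open>v = x - u\<close> of two unit vectors satisfies \<open>v\<^sup>* v = 2 - 2 Re (x\<^sup>* u)\<close> and \<open>v\<^sup>* x = 1 - u\<^sup>* x\<close>; only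
  for real \<open>x\<^sup>* u\<close> is the former twice the latter, which is what the reflection needs in
  order to subtract exactly \<open>v\<close> from \<open>x\<close>.
\<close>

lemma householder_maps:
  assumes "norm x = 1" "norm u = 1" "cinner x u \<in> \<real>"
  shows "householder (x - u) *v x = u"
proof (cases "x = u")
  case True
  then show ?thesis
    by (simp add: householder_mult)
next
  case False
  have eq: "cinner u x = cinner x u"
    using assms(3) by (metis Reals_cnj_iff cnj_cinner)
  have "cinner (x - u) (x - u) = 2 * cinner (x - u) x"
    unfolding cinner_diff_left cinner_diff_right using assms(1,2) eq
    by (simp add: cinner_self)
  then have "of_real ((norm (x - u))\<^sup>2) = 2 * cinner (x - u) x"
    by (simp only: cinner_self)
  then have "of_real (2 / (norm (x - u))\<^sup>2) * cinner (x - u) x = 1"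
    using False by (auto simp: divide_simps)
  then show ?thesis
    by (simp add: householder_mult)
qed

text \<open>
  A general \<open>b\<close> is reached by rescaling the reflection onto \<open>b / \<parallel>b\<parallel>\<close>, and the result has
  spectral norm \<open>\<parallel>b\<parallel>\<close>, the least possible as \<open>x\<close> is a unit vector.
\<close>

lemma Hermitian_mapping:
  assumes "norm x = 1" "cinner x b \<in> \<real>"
  obtains D where "D \<in> Herm" "D *v x = b" "spectral_norm D \<le> norm b"
proof -
  \<comment> \<open>For \<open>b = 0\<close> any unit vector \<open>u\<close> with \<open>x\<^sup>* u\<close> real would do, since \<open>D\<close> is then zero.\<close>
  define u where "u = (if b = 0 then x else of_real (1 / norm b) *s b)"
  define D where "D = (\<chi> i j. of_real (norm b) * householder (x - u) $ i $ j)"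
  have D: "D *v y = norm b *\<^sub>R (householder (x - u) *v y)" for y
    by (simp add: D_def vec_eq_iff matrix_vector_mult_def)
      (simp add: scaleR_conv_of_real sum_distrib_left mult.assoc)
  have "norm u = 1"
    using assms(1) by (simp only: u_def scaled_eq_scaleR) simp
  moreover have "cinner x u \<in> \<real>"
    using assms by (auto simp only: u_def cinner_scale_right cinner_self split: if_splits
        intro!: Reals_mult Reals_of_real)
  ultimately have u: "householder (x - u) *v x = u"
    using assms(1) by (intro householder_maps)
  have "D \<in> Herm"
    using householder_Herm[of "x - u"]
    by (simp add: Herm_def D_def conj_transpose_def vec_eq_iff)
  moreover have "D *v x = b"
    unfolding D u by (simp only: u_def scaled_eq_scaleR) simp
  moreover have "spectral_norm D \<le> norm b"
    unfolding spectral_norm_def by (rule onorm_le) (simp add: D norm_householder)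
  ultimately show ?thesis
    by (rule that)
qed

lemma cinner_Herm_Reals: "A \<in> Herm \<Longrightarrow> cinner x (A *v x) \<in> \<real>"
  using cinner_conj_transpose[of A x x]
  by (simp add: Herm_def Reals_cnj_iff cnj_cinner)

section \<open>The distance to a common null space\<close>

lemma common_null_iff: "ker M \<inter> ker N \<noteq> {0} \<longleftrightarrow> (\<exists>x. x \<noteq> 0 \<and> M *v x = 0 \<and> N *v x = 0)"
proof -
  have "0 \<in> ker M \<inter> ker N"
    by (simp add: ker_def)
  then have "ker M \<inter> ker N \<noteq> {0} \<longleftrightarrow> (\<exists>x \<in> ker M \<inter> ker N. x \<noteq> 0)"
    by blast
  then show ?thesis
    by (auto simp: ker_def)
qed

text \<open>
  On a common null vector the perturbations act exactly as \<open>A\<close> and \<open>E\<close>, so their norms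
  dominate the Rayleigh quotient of the Gram matrix there.
\<close>

lemma dist_common_null_lower_bound:
  "ereal (sqrt (lambda_min (conj_transpose A ** A + conj_transpose E ** E)))
    \<le> dist_common_null S A E"
  unfolding dist_common_null_def
proof (rule Inf_greatest, clarify)
  let ?l = "lambda_min (conj_transpose A ** A + conj_transpose E ** E)"
  fix DA DE
  assume "ker (A - DA) \<inter> ker (E - DE) \<noteq> {0}"
  then obtain x where "x \<noteq> 0" and x: "A *v x = DA *v x" "E *v x = DE *v x"
    by (auto simp: common_null_iff matrix_vector_mult_diff_rdistrib)
  have "?l * (norm x)\<^sup>2 \<le> (norm (DA *v x))\<^sup>2 + (norm (DE *v x))\<^sup>2"
    using Rayleigh_principle[OF gram_Herm[of A E]] gram_form[of x A E] by (metis x)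
  also have "\<dots> \<le> (spectral_norm DA * norm x)\<^sup>2 + (spectral_norm DE * norm x)\<^sup>2"
    unfolding spectral_norm_def
    by (intro add_mono power_mono onorm bounded_linear_matrix norm_ge_zero)
  also have "\<dots> = ((spectral_norm DA)\<^sup>2 + (spectral_norm DE)\<^sup>2) * (norm x)\<^sup>2"
    by (simp add: power_mult_distrib algebra_simps)
  finally show "ereal (sqrt ?l) \<le> ereal (sqrt ((spectral_norm DA)\<^sup>2 + (spectral_norm DE)\<^sup>2))"
    using \<open>x \<noteq> 0\<close> by simp
qed

lemma dist_common_null_Herm_upper_bound:
  assumes "A \<in> Herm" "E \<in> Herm"
  shows "dist_common_null (Herm \<times> Herm) A E
    \<le> ereal (sqrt (lambda_min (conj_transpose A ** A + conj_transpose E ** E)))"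
proof -
  let ?l = "lambda_min (conj_transpose A ** A + conj_transpose E ** E)"
  obtain x where x: "norm x = 1" and l: "(norm (A *v x))\<^sup>2 + (norm (E *v x))\<^sup>2 = ?l"
    using Rayleigh_principle[OF gram_Herm[of A E]] gram_form[of _ A E] by metis
  obtain DA where DA: "DA \<in> Herm" "DA *v x = A *v x" "spectral_norm DA \<le> norm (A *v x)"
    using Hermitian_mapping[OF x cinner_Herm_Reals[OF assms(1)]] .
  obtain DE where DE: "DE \<in> Herm" "DE *v x = E *v x" "spectral_norm DE \<le> norm (E *v x)"
    using Hermitian_mapping[OF x cinner_Herm_Reals[OF assms(2)]] .
  have "ker (A - DA) \<inter> ker (E - DE) \<noteq> {0}"
    unfolding common_null_iff using x DA(2) DE(2)
    by (intro exI[of _ x]) (auto simp: matrix_vector_mult_diff_rdistrib)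
  then have "dist_common_null (Herm \<times> Herm) A E
      \<le> ereal (sqrt ((spectral_norm DA)\<^sup>2 + (spectral_norm DE)\<^sup>2))"
    unfolding dist_common_null_def using DA(1) DE(1) by (intro Inf_lower) auto
  also have "(spectral_norm DA)\<^sup>2 + (spectral_norm DE)\<^sup>2 \<le> ?l"
    unfolding l[symmetric] using DA(3) DE(3)
    by (intro add_mono power_mono)
      (simp_all add: spectral_norm_def onorm_pos_le[OF bounded_linear_matrix])
  finally show ?thesis
    by simp
qed

lemma dist_common_null_antimono:
  "S \<subseteq> T \<Longrightarrow> dist_common_null T A E \<le> dist_common_null S A E"
  unfolding dist_common_null_def by (intro Inf_superset_mono) auto

theorem theorem3p4:
  fixes A E :: "complex^'n^'n"
  assumes "A \<in> Herm" and "E \<in> Herm"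
    and "regular_pencil A E"
  shows "dist_common_null (Herm \<times> Herm) A E
           = ereal (sqrt (lambda_min (conj_transpose A ** A + conj_transpose E ** E)))
       \<and> ereal (sqrt (lambda_min (conj_transpose A ** A + conj_transpose E ** E)))
           = dist_common_null UNIV A E"
  using dist_common_null_lower_bound[of A E "Herm \<times> Herm"]
    dist_common_null_lower_bound[of A E UNIV]
    dist_common_null_Herm_upper_bound[OF assms(1,2)]
    dist_common_null_antimono[of "Herm \<times> Herm" UNIV A E]
  by (auto intro: antisym order_trans)

end
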